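(* Let $p,q\in\mathbb{C}$, $h\in\mathbb{C}\setminus\{0\}$, let $r\ge 1$, ${\bf m}=(m_1,\dots,m_r)\in\mathbb{N}_0^r$, ${\bf n}=(n_1,\dots,n_r)\in\mathbb{N}_0^r$, and let $\mathrm{w}_{{\bf m},{\bf n}}=Y^{n_r}X^{m_r}\cdots Y^{n_1}X^{m_1}$ be a word in the generators $X,Y$ of the $(p,q)$-deformed Weyl algebra $A_{0;h|p,q}$. Then in $A_{0;h|p,q}$ one has $$\mathrm{w}_{{\bf m},{\bf n}}=\sum_{k=0}^{|{\bf m}|-m_1}\mathscr{R}_{h;p,q}[B_{\mathrm{w}_{{\bf m},{\bf n}}},k]\;Y^{|{\bf n}|-k}Z_p^{k}X^{|{\bf m}|-k},$$ where $B_{\mathrm{w}_{{\bf m},{\bf n}}}$ is the Ferrers board associated to $\mathrm{w}_{{\bf m},{\bf n}}$, and $|{\bf m}|=\sum_j m_j$, $|{\bf n}|=\sum_j n_j$.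
   Context: $\mathbb{N}_0=\{0,1,2,\dots\}$. The algebra $A_{0;h|p,q}$ is the complex unital algebra generated by $X,Y,Z_p$ subject to $XY-qYX=hZ_p$, $Z_pY=pYZ_p$, $XZ_p=pZ_pX$, with the convention $Z_1=I$ (i.e. for $p=1$ the element $Z_p$ is the identity). Ferrers board of a word. A Ferrers board is a top-justified arrangement of columns of boxes whose heights weakly decrease from left to right. For a word $w$ in $X$ and $Y$, start at $(0,0)$ and, reading $w$ from left to right, draw a unit step to the right for each $X$ and a unit step up for each $Y$. The resulting path outlines (as its lower-right boundary) the Ferrers board $B_w$. Equivalently: the columns of $B_w$, from left to right, correspond to the letters $X$ of $w$ from left to right, the rows, from bottom to top, correspond to the letters $Y$ from left to right, and there is a box in the column of a given $X$ and the row of a given $Y$ exactly when this $X$ occurs to the left of this $Y$ in $w$ (columns of height $0$ are allowed). Rook placements and weights. For a Ferrers board $B$, let $\mathcal{R}(B,k)$ be the set of placements of $k$ non-attacking rooks on $B$ (no two in the same row or column). Given $\phi\in\mathcal{R}(B,k)$, the boxes of $B$ are divided into: rook boxes (occupied by a rook); $p$-boxes, i.e. non-rook boxes which either lie above a rook (in its column) and not to the left of another rook (in its row), or lie to the left of a rook (in its row) and not in the column of another rook; cancelled boxes, i.e. non-rook boxes lying above or to the left of a rook which are not $p$-boxes; and $q$-boxes, all remaining boxes. The weight is $\omega_{p,q}(B;\phi)=h^k p^{\#p\text{-boxes}}q^{\#q\text{-boxes}}$, and the $(p,q)$-deformed rook numbers are $$\mathscr{R}_{h;p,q}[B,k]=\sum_{\phi\in\mathcal{R}(B,k)}\omega_{p,q}(B;\phi),$$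 which is $0$ if there are no such placements. Terms with $k>|{\bf n}|$ have rook number $0$ and are read as $0$. *)

theory Defs
  imports Complex_Main "HOL-Algebra.QuotRing" "HOL-Library.Poly_Mapping"
begin

section \<open>The free complex algebra on three generators\<close>

datatype generator = GenX | GenY | GenZ

text \<open>Words in the generators, as the free monoid. The monoid is written additively only because the
  convolution product of \<^typ>\<open>'a \<Rightarrow>\<^sub>0 'b\<close> expects its exponents in class \<^class>\<open>monoid_add\<close>;
  addition is concatenation and is not commutative.\<close>

datatype gen_word = Gen_Word (letters: "generator list")

instantiation gen_word :: monoid_add
begin
definition zero_gen_word :: gen_word where "0 = Gen_Word []"
definition plus_gen_word :: "gen_word \<Rightarrow> gen_word \<Rightarrow> gen_word"
  where "u + v = Gen_Word (letters u @ letters v)"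
instance
  by standard (simp_all add: zero_gen_word_def plus_gen_word_def)
end

text \<open>Finitely supported functions from words to the complex numbers: the monoid algebra of the free
  monoid, that is, the free unital algebra.\<close>

type_synonym free_poly = "gen_word \<Rightarrow>\<^sub>0 complex"

definition free_gen :: "generator \<Rightarrow> free_poly"
  where "free_gen g = Poly_Mapping.single (Gen_Word [g]) 1"

definition free_const :: "complex \<Rightarrow> free_poly"
  where "free_const c = Poly_Mapping.single 0 c"

definition free_alg :: "free_poly ring"
  where "free_alg = \<lparr>carrier = UNIV, monoid.mult = (*), one = 1, ring.zero = 0, add = (+)\<rparr>"

lemma ring_free_alg: "ring free_alg"
proof (rule ringI)
  show "abelian_group free_alg"
  proof (rule abelian_groupI)
    fix a :: free_poly
    show "\<exists>b\<in>carrier free_alg. b \<oplus>\<^bsub>free_alg\<^esub> a = \<zero>\<^bsub>free_alg\<^esub>"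
      by (rule bexI[of _ "- a"]) (simp_all add: free_alg_def)
  qed (simp_all add: free_alg_def ac_simps)
  show "monoid free_alg"
    by (rule monoidI) (simp_all add: free_alg_def mult.assoc)
qed (simp_all add: free_alg_def algebra_simps)

section \<open>The $(p,q)$-deformed Weyl algebra\<close>

text \<open>The last set implements the convention $Z_1 = I$.\<close>

definition weyl_relators :: "complex \<Rightarrow> complex \<Rightarrow> complex \<Rightarrow> free_poly set"
  where "weyl_relators h p q =
    (let X = free_gen GenX; Y = free_gen GenY; Z = free_gen GenZ in
      {X * Y - free_const q * (Y * X) - free_const h * Z,
       Z * Y - free_const p * (Y * Z),
       X * Z - free_const p * (Z * X)}
      \<union> (if p = 1 then {Z - 1} else {}))"

text \<open>Ideals of \<^const>\<open>free_alg\<close> are two-sided. They are closed under scalar multiplication because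
  the scalars are the elements \<^term>\<open>free_const c\<close> of the ring itself; so the quotient by the
  ring ideal generated by the relators is the quotient as an algebra.\<close>

definition weyl_ideal :: "complex \<Rightarrow> complex \<Rightarrow> complex \<Rightarrow> free_poly set"
  where "weyl_ideal h p q = Idl\<^bsub>free_alg\<^esub> (weyl_relators h p q)"

definition weyl_alg :: "complex \<Rightarrow> complex \<Rightarrow> complex \<Rightarrow> free_poly set ring"
  where "weyl_alg h p q = free_alg Quot (weyl_ideal h p q)"

definition weyl_class :: "complex \<Rightarrow> complex \<Rightarrow> complex \<Rightarrow> free_poly \<Rightarrow> free_poly set"
  where "weyl_class h p q a = weyl_ideal h p q +>\<^bsub>free_alg\<^esub> a"

definition weyl_X :: "complex \<Rightarrow> complex \<Rightarrow> complex \<Rightarrow> free_poly set"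
  where "weyl_X h p q = weyl_class h p q (free_gen GenX)"

definition weyl_Y :: "complex \<Rightarrow> complex \<Rightarrow> complex \<Rightarrow> free_poly set"
  where "weyl_Y h p q = weyl_class h p q (free_gen GenY)"

definition weyl_Z :: "complex \<Rightarrow> complex \<Rightarrow> complex \<Rightarrow> free_poly set"
  where "weyl_Z h p q = weyl_class h p q (free_gen GenZ)"

definition weyl_smult :: "complex \<Rightarrow> complex \<Rightarrow> complex \<Rightarrow> complex \<Rightarrow> free_poly set \<Rightarrow> free_poly set"
  where "weyl_smult h p q c u = weyl_class h p q (free_const c) \<otimes>\<^bsub>weyl_alg h p q\<^esub> u"

lemma ideal_weyl_ideal: "ideal (weyl_ideal h p q) free_alg"
  unfolding weyl_ideal_def
  by (rule ring.genideal_ideal[OF ring_free_alg]) (simp add: free_alg_def)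

lemma ring_weyl_alg: "ring (weyl_alg h p q)"
  unfolding weyl_alg_def by (rule ideal.quotient_is_ring[OF ideal_weyl_ideal])

section \<open>Words in $X$ and $Y$\<close>

datatype letter = LX | LY

primrec weyl_letter :: "complex \<Rightarrow> complex \<Rightarrow> complex \<Rightarrow> letter \<Rightarrow> free_poly set"
  where
    "weyl_letter h p q LX = weyl_X h p q"
  | "weyl_letter h p q LY = weyl_Y h p q"

primrec weyl_word :: "complex \<Rightarrow> complex \<Rightarrow> complex \<Rightarrow> letter list \<Rightarrow> free_poly set"
  where
    "weyl_word h p q [] = \<one>\<^bsub>weyl_alg h p q\<^esub>"
  | "weyl_word h p q (x # w) = weyl_letter h p q x \<otimes>\<^bsub>weyl_alg h p q\<^esub> weyl_word h p q w"

text \<open>The word $Y^{n_r} X^{m_r} \cdots Y^{n_1} X^{m_1}$; only the values of \<^term>\<open>m\<close> and \<^term>\<open>n\<close>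
  on \<^term>\<open>{1..r}\<close> matter.\<close>

definition word_mn :: "nat \<Rightarrow> (nat \<Rightarrow> nat) \<Rightarrow> (nat \<Rightarrow> nat) \<Rightarrow> letter list"
  where "word_mn r m n =
    concat (map (\<lambda>j. replicate (n j) LY @ replicate (m j) LX) (rev [1..<Suc r]))"

section \<open>Boards and rook numbers\<close>

text \<open>A box is the pair (column, row), columns counted from left to right and rows from bottom to top,
  both from 0; it is the unit square with that lower-left corner. The \<^term>\<open>X\<close> at position \<^term>\<open>i\<close>
  of the word sits over the column whose index is the number of \<^term>\<open>X\<close> before it, and similarly
  for rows and \<^term>\<open>Y\<close>.\<close>

type_synonym box = "nat \<times> nat"

definition ferrers_board :: "letter list \<Rightarrow> box set"
  where "ferrers_board w =
    {(count_list (take i w) LX, count_list (take j w) LY) | i j.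
       i < j \<and> j < length w \<and> w ! i = LX \<and> w ! j = LY}"

definition rook_placements :: "box set \<Rightarrow> nat \<Rightarrow> box set set"
  where "rook_placements B k =
    {\<phi>. \<phi> \<subseteq> B \<and> finite \<phi> \<and> card \<phi> = k \<and>
       (\<forall>a\<in>\<phi>. \<forall>b\<in>\<phi>. a \<noteq> b \<longrightarrow> fst a \<noteq> fst b \<and> snd a \<noteq> snd b)}"

definition above_rook :: "box set \<Rightarrow> box \<Rightarrow> bool"
  where "above_rook \<phi> b \<longleftrightarrow> (\<exists>a\<in>\<phi>. fst a = fst b \<and> snd a < snd b)"

definition left_of_rook :: "box set \<Rightarrow> box \<Rightarrow> bool"
  where "left_of_rook \<phi> b \<longleftrightarrow> (\<exists>a\<in>\<phi>. snd a = snd b \<and> fst b < fst a)"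

definition in_rook_column :: "box set \<Rightarrow> box \<Rightarrow> bool"
  where "in_rook_column \<phi> b \<longleftrightarrow> (\<exists>a\<in>\<phi>. fst a = fst b)"

text \<open>For a non-rook box the rook below or above it (same column) and the rook to its right (same row)
  are necessarily different, so ``another'' rook needs no separate condition.\<close>

definition p_boxes :: "box set \<Rightarrow> box set \<Rightarrow> box set"
  where "p_boxes B \<phi> =
    {b \<in> B - \<phi>. (above_rook \<phi> b \<and> \<not> left_of_rook \<phi> b) \<or>
                (left_of_rook \<phi> b \<and> \<not> in_rook_column \<phi> b)}"

definition cancelled_boxes :: "box set \<Rightarrow> box set \<Rightarrow> box set"
  where "cancelled_boxes B \<phi> =
    {b \<in> B - \<phi>. above_rook \<phi> b \<or> left_of_rook \<phi> b} - p_boxes B \<phi>"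

definition q_boxes :: "box set \<Rightarrow> box set \<Rightarrow> box set"
  where "q_boxes B \<phi> = B - \<phi> - p_boxes B \<phi> - cancelled_boxes B \<phi>"

definition rook_weight ::
    "complex \<Rightarrow> complex \<Rightarrow> complex \<Rightarrow> box set \<Rightarrow> nat \<Rightarrow> box set \<Rightarrow> complex"
  where "rook_weight h p q B k \<phi> = h ^ k * p ^ card (p_boxes B \<phi>) * q ^ card (q_boxes B \<phi>)"

definition rook_number :: "complex \<Rightarrow> complex \<Rightarrow> complex \<Rightarrow> box set \<Rightarrow> nat \<Rightarrow> complex"
  where "rook_number h p q B k = (\<Sum>\<phi>\<in>rook_placements B k. rook_weight h p q B k \<phi>)"

end

theory Submission
  imports Defs
begin

text \<open>Read the word from left to right. Appending an \<open>X\<close> appends an empty column to the board and only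
  raises the power of \<open>X\<close> in the normal form. Appending a \<open>Y\<close> adds a full top row. On the algebra
  side, \<open>X\<^sup>b Y = q\<^sup>b Y X\<^sup>b + h [b] Z X\<^bsup>b-1\<^esup>\<close> with \<open>[b] = \<Sum>\<^bsub>i<b\<^esub> p\<^sup>i q\<^bsup>b-1-i\<^esup>\<close>, and \<open>Z\<^sup>k Y = p\<^sup>k Y Z\<^sup>k\<close>. The rook
  numbers obey the same recursion: over a placement of \<open>k\<close> rooks leaving \<open>b\<close> columns free, an empty
  new row has weight \<open>p\<^sup>k q\<^sup>b\<close>, and a rook in the new row sits in a free column and contributes
  \<open>h p\<^sup>i q\<^bsup>b-1-i\<^esup>\<close>, where \<open>i\<close> counts the free columns to its left.\<close>

section \<open>Rook numbers of a board with an added top row\<close>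

lemma q_boxes_alt: "q_boxes B \<phi> = {b \<in> B - \<phi>. \<not> above_rook \<phi> b \<and> \<not> left_of_rook \<phi> b}"
  by (auto simp: q_boxes_def cancelled_boxes_def p_boxes_def)

lemma rook_placementsD:
  assumes "\<phi> \<in> rook_placements B k"
  shows "\<phi> \<subseteq> B" "finite \<phi>" "card \<phi> = k" "inj_on fst \<phi>" "inj_on snd \<phi>"
    "card (fst ` \<phi>) = k" "card (snd ` \<phi>) = k"
proof -
  show "\<phi> \<subseteq> B" "finite \<phi>" and k: "card \<phi> = k"
    using assms by (auto simp: rook_placements_def)
  show "inj_on fst \<phi>" "inj_on snd \<phi>"
    using assms unfolding rook_placements_def inj_on_def by blast+
  then show "card (fst ` \<phi>) = k" "card (snd ` \<phi>) = k"
    using k by (simp_all add: card_image)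
qed

lemma rook_placementsI:
  assumes "\<phi> \<subseteq> B" "finite \<phi>" "card \<phi> = k" "inj_on fst \<phi>" "inj_on snd \<phi>"
  shows "\<phi> \<in> rook_placements B k"
  using assms unfolding rook_placements_def inj_on_def by blast

lemma finite_rook_placements: "finite B \<Longrightarrow> finite (rook_placements B k)"
  by (rule finite_subset[of _ "Pow B"]) (auto simp: rook_placements_def)

text \<open>Pigeonhole: rooks occupy distinct columns. This removes the extra summand when an
  \<open>X\<close> is appended, and later gives the upper summation bound.\<close>

lemma rook_number_eq_0_cols:
  assumes "fst ` B \<subseteq> {..<x}" "x < k"
  shows "rook_number h p q B k = 0"
proof -
  have "rook_placements B k = {}"
  proof (rule equals0I)
    fix \<phi> assume \<phi>: "\<phi> \<in> rook_placements B k"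
    have "fst ` \<phi> \<subseteq> {..<x}"
      using rook_placementsD(1)[OF \<phi>] assms(1) by blast
    from card_mono[OF _ this] show False
      using rook_placementsD(6)[OF \<phi>] assms(2) by simp
  qed
  then show ?thesis by (simp add: rook_number_def)
qed

text \<open>Rooks occupy distinct rows. This guards the places where \<open>k\<close> exceeds the
  number of \<open>Y\<close>s and the truncated exponent of \<open>Y\<close> would be wrong.\<close>

lemma rook_number_eq_0_rows:
  assumes "snd ` B \<subseteq> {..<y}" "y < k"
  shows "rook_number h p q B k = 0"
proof -
  have "rook_placements B k = {}"
  proof (rule equals0I)
    fix \<phi> assume \<phi>: "\<phi> \<in> rook_placements B k"
    have "snd ` \<phi> \<subseteq> {..<y}"
      using rook_placementsD(1)[OF \<phi>] assms(1) by blast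
    from card_mono[OF _ this] show False
      using rook_placementsD(7)[OF \<phi>] assms(2) by simp
  qed
  then show ?thesis by (simp add: rook_number_def)
qed

lemma rook_number_0: "rook_number h p q B 0 = q ^ card B"
proof -
  have "rook_placements B 0 = {{}}"
    by (auto simp: rook_placements_def)
  then show ?thesis
    by (simp add: rook_number_def rook_weight_def p_boxes_def q_boxes_alt above_rook_def
        left_of_rook_def)
qed

text \<open>A division-free form of \<open>(p ^ n - q ^ n) / (p - q)\<close> that also covers
  \<open>p = q\<close>. The recursion fits both uses: one more free column at the right end, and one
  more factor \<open>X\<close>.\<close>

primrec pq_number :: "'a::comm_semiring_1 \<Rightarrow> 'a \<Rightarrow> nat \<Rightarrow> 'a"
  where
    "pq_number p q 0 = 0"
  | "pq_number p q (Suc n) = q * pq_number p q n + p ^ n"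

text \<open>Only the rank of an element in \<open>S\<close> matters. A new maximum \<open>b\<close>
  has all of \<open>A\<close> below it and contributes \<open>p ^ card A\<close>, while every older
  element gains one larger element, hence a factor \<open>q\<close>.\<close>

lemma sum_over_set_eq_pq_number:
  fixes S :: "'b::linorder set"
  assumes "finite S"
  shows "(\<Sum>c\<in>S. p ^ card {s\<in>S. s < c} * q ^ card {s\<in>S. c < s}) = pq_number p q (card S)"
  using assms
proof (induction S rule: finite_linorder_max_induct)
  case (insert b A)
  have b: "b \<notin> A" using insert.hyps by blast
  have "(\<Sum>c\<in>insert b A. p ^ card {s\<in>insert b A. s < c} * q ^ card {s\<in>insert b A. c < s})
    = p ^ card A + (\<Sum>c\<in>A. p ^ card {s\<in>A. s < c} * q ^ Suc (card {s\<in>A. c < s}))"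
  proof -
    have lo: "{s\<in>insert b A. s < b} = A" and hi: "{s\<in>insert b A. b < s} = {}"
      using insert.hyps by (auto dest: less_asym)
    have lo': "{s\<in>insert b A. s < c} = {s\<in>A. s < c}"
      and hi': "{s\<in>insert b A. c < s} = insert b {s\<in>A. c < s}" if "c \<in> A" for c
      using insert.hyps(2) that by (auto dest: less_asym)
    show ?thesis
      unfolding sum.insert[OF insert.hyps(1) b] lo hi
      using insert.hyps(1) b by (simp add: lo' hi' cong: sum.cong del: insert_iff)
  qed
  also have "\<dots> = p ^ card A + q * (\<Sum>c\<in>A. p ^ card {s\<in>A. s < c} * q ^ card {s\<in>A. c < s})"
    by (simp add: sum_distrib_left mult_ac)
  finally show ?case
    using insert.IH insert.hyps(1) b by (simp add: add.commute)
qed simp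

text \<open>Row \<open>y\<close> lies strictly above \<open>B\<close>, so a full row can be added
  there. The width \<open>x\<close> includes columns of height 0, which the new row also covers.
  Left closure ensures that every position to the left of a rook is a box of
  \<open>B\<close>.\<close>

locale rectangle_board =
  fixes B :: "box set" and x y :: nat
  assumes in_rectangle: "B \<subseteq> {..<x} \<times> {..<y}"
    and left_closed: "\<And>c r c'. (c, r) \<in> B \<Longrightarrow> c' < c \<Longrightarrow> (c', r) \<in> B"
begin

abbreviation (input) B' :: "box set"
  where "B' \<equiv> B \<union> {..<x} \<times> {y}"

lemma fin: "finite B"
  using in_rectangle finite_subset by blast

lemma row_less: "b \<in> B \<Longrightarrow> snd b < y" and col_less: "b \<in> B \<Longrightarrow> fst b < x"
  using in_rectangle by auto

context
  fixes \<phi> k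
  assumes \<phi>: "\<phi> \<in> rook_placements B k"
begin

lemma \<phi>_row_less: "a \<in> \<phi> \<Longrightarrow> snd a < y" and \<phi>_col_less: "a \<in> \<phi> \<Longrightarrow> fst a < x"
  using rook_placementsD(1)[OF \<phi>] row_less col_less by blast+

lemma rook_cols: "fst ` \<phi> \<subseteq> {..<x}"
  using \<phi>_col_less by blast

lemma top_notin: "(c, y) \<notin> \<phi>" "(c, y) \<notin> B"
  using \<phi>_row_less row_less by force+

lemma not_left_top: "\<not> left_of_rook \<phi> (c, y)"
  using \<phi>_row_less unfolding left_of_rook_def by force

lemma above_top: "above_rook \<phi> (c, y) \<longleftrightarrow> c \<in> fst ` \<phi>"
  using \<phi>_row_less unfolding above_rook_def by force

lemma card_free: "card ({..<x} - fst ` \<phi>) = x - k"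
  using rook_cols rook_placementsD(2,6)[OF \<phi>] by (simp add: card_Diff_subset)

text \<open>Boxes of \<open>B\<close> keep their type. With no rook in the top row, a box there is a
  p-box over each of the \<open>k\<close> rook columns and a q-box over each of the
  \<open>x - k\<close> free ones.\<close>

lemma rook_weight_empty_row:
  "rook_weight h p q B' k \<phi> = p ^ k * q ^ (x - k) * rook_weight h p q B k \<phi>"
proof -
  define C where "C = fst ` \<phi>"
  note [simp] = above_top[folded C_def]
  have "p_boxes B' \<phi> = p_boxes B \<phi> \<union> C \<times> {y}"
    using rook_cols top_notin not_left_top unfolding p_boxes_def C_def[symmetric] by auto
  then have P: "p_boxes B' \<phi> = p_boxes B \<phi> \<union> fst ` \<phi> \<times> {y}"
    by (simp add: C_def)
  have "q_boxes B' \<phi> = q_boxes B \<phi> \<union> ({..<x} - C) \<times> {y}"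
    using top_notin not_left_top unfolding q_boxes_alt by auto
  then have Q: "q_boxes B' \<phi> = q_boxes B \<phi> \<union> ({..<x} - fst ` \<phi>) \<times> {y}"
    by (simp add: C_def)
  have "card (p_boxes B' \<phi>) = card (p_boxes B \<phi>) + k"
    unfolding P using fin top_notin rook_placementsD(2,6)[OF \<phi>]
    by (subst card_Un_disjoint) (auto simp: p_boxes_def card_cartesian_product)
  moreover have "card (q_boxes B' \<phi>) = card (q_boxes B \<phi>) + (x - k)"
    unfolding Q using fin top_notin card_free
    by (subst card_Un_disjoint) (auto simp: q_boxes_alt card_cartesian_product)
  ultimately show ?thesis
    by (simp add: rook_weight_def power_add mult_ac)
qed

text \<open>To the left of the new rook, top boxes over free columns are p-boxes and those over rook
  columns are cancelled. To its right, free columns give q-boxes and rook columns give p-boxes. The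
  last kind is compensated by p-boxes lost in column \<open>c\<close>, so only the counts of free
  columns remain.\<close>

lemma rook_weight_rook_in_row:
  assumes c: "c < x" "c \<notin> fst ` \<phi>"
  shows "rook_weight h p q B' (Suc k) (insert (c, y) \<phi>) =
    h * (p ^ card {s \<in> {..<x} - fst ` \<phi>. s < c} * q ^ card {s \<in> {..<x} - fst ` \<phi>. c < s})
      * rook_weight h p q B k \<phi>"
proof -
  let ?\<psi> = "insert (c, y) \<phi>"
  let ?F = "{..<x} - fst ` \<phi>"
  \<comment> \<open>\<open>L\<close> collects the p-boxes that are lost, \<open>R\<close> the top
    p-boxes over older rooks.\<close>
  define L where "L = {b \<in> B. fst b = c \<and> left_of_rook \<phi> b}"
  define R where "R = {s \<in> fst ` \<phi>. c < s} \<times> {y}"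
  \<comment> \<open>The new rook is higher than every box of \<open>B\<close>, so on
    \<open>B\<close> it affects only \<open>in_rook_column\<close>, and that only in column
    \<open>c\<close>.\<close>
  have low: "above_rook ?\<psi> b = above_rook \<phi> b" "left_of_rook ?\<psi> b = left_of_rook \<phi> b"
    "b \<in> ?\<psi> \<longleftrightarrow> b \<in> \<phi>" "in_rook_column ?\<psi> b \<longleftrightarrow> in_rook_column \<phi> b \<or> fst b = c" if "b \<in> B" for b
    using row_less[OF that] by (auto simp: above_rook_def left_of_rook_def in_rook_column_def)
  have top: "above_rook ?\<psi> (s, y) \<longleftrightarrow> s \<in> fst ` \<phi>" "left_of_rook ?\<psi> (s, y) \<longleftrightarrow> s < c"
    "(s, y) \<in> ?\<psi> \<longleftrightarrow> s = c" "in_rook_column ?\<psi> (s, y) \<longleftrightarrow> s = c \<or> s \<in> fst ` \<phi>" for s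
    using \<phi>_row_less by (force simp: above_rook_def left_of_rook_def in_rook_column_def)+
  have nc: "\<not> in_rook_column \<phi> (c, s)" "\<not> above_rook \<phi> (c, s)" "(c, s) \<notin> \<phi>" for s
    using c(2) by (force simp: in_rook_column_def above_rook_def)+
  have P: "p_boxes B' ?\<psi> = (p_boxes B \<phi> - L) \<union> ({s \<in> ?F. s < c} \<times> {y} \<union> R)" (is "?l = ?r")
  proof (rule Set.set_eqI)
    fix b :: box
    obtain s t where b: "b = (s, t)" by force
    show "b \<in> ?l \<longleftrightarrow> b \<in> ?r"
    proof (cases "t = y")
      case True
      then show ?thesis
        using c top_notin rook_cols top[of s]
        unfolding b p_boxes_def R_def L_def by auto
    next
      case False
      then show ?thesis
        using low[of b] nc[of t] unfolding b p_boxes_def R_def L_def by auto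
    qed
  qed
  have Q: "q_boxes B' ?\<psi> = q_boxes B \<phi> \<union> {s \<in> ?F. c < s} \<times> {y}" (is "?l = ?r")
  proof (rule Set.set_eqI)
    fix b :: box
    obtain s t where b: "b = (s, t)" by force
    show "b \<in> ?l \<longleftrightarrow> b \<in> ?r"
    proof (cases "t = y")
      case True
      then show ?thesis
        using c top_notin top[of s] unfolding b q_boxes_alt by auto
    next
      case False
      then show ?thesis
        using low[of b] unfolding b q_boxes_alt by auto
    qed
  qed
  have "L \<subseteq> p_boxes B \<phi>"
    using nc unfolding L_def p_boxes_def by auto
  \<comment> \<open>Each rook to the right of column \<open>c\<close> turns one \<open>p\<close>-box of that column into a cancelled box and
    creates one \<open>p\<close>-box in the top row.\<close>
  have "L = (\<lambda>a. (c, snd a)) ` {a \<in> \<phi>. c < fst a}"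
  proof (intro equalityI subsetI)
    fix b assume "b \<in> L"
    then obtain a where "a \<in> \<phi>" "snd a = snd b" "fst b < fst a" "fst b = c"
      unfolding L_def left_of_rook_def by blast
    then show "b \<in> (\<lambda>a. (c, snd a)) ` {a \<in> \<phi>. c < fst a}"
      by (intro image_eqI[of _ _ a]) (auto simp: prod_eq_iff)
  next
    fix b assume "b \<in> (\<lambda>a. (c, snd a)) ` {a \<in> \<phi>. c < fst a}"
    then obtain a where a: "a \<in> \<phi>" "c < fst a" "b = (c, snd a)"
      by blast
    \<comment> \<open>The rook \<open>a\<close> is a box of \<open>B\<close> in the same row and
      further right, so left closure applies.\<close>
    then have "b \<in> B"
      using left_closed[of "fst a" "snd a" c] rook_placementsD(1)[OF \<phi>] by auto
    then show "b \<in> L"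
      using a by (auto simp: L_def left_of_rook_def)
  qed
  moreover have "inj_on (\<lambda>a. (c, snd a)) {a \<in> \<phi>. c < fst a}"
    using rook_placementsD(5)[OF \<phi>] by (auto simp: inj_on_def)
  ultimately have "card L = card {a \<in> \<phi>. c < fst a}"
    by (simp add: card_image)
  moreover have "card R = card {a \<in> \<phi>. c < fst a}"
  proof -
    have "{s \<in> fst ` \<phi>. c < s} = fst ` {a \<in> \<phi>. c < fst a}"
      by blast
    moreover have "inj_on fst {a \<in> \<phi>. c < fst a}"
      using rook_placementsD(4)[OF \<phi>] by (auto simp: inj_on_def)
    ultimately show ?thesis
      by (simp add: R_def card_cartesian_product card_image)
  qed
  ultimately have LR: "card L = card R" by simp
  have finP: "finite (p_boxes B \<phi>)" and finL: "finite L" and finR: "finite R"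
    using fin rook_placementsD(2)[OF \<phi>] by (auto simp: p_boxes_def L_def R_def)
  have "card (p_boxes B' ?\<psi>) = card (p_boxes B \<phi> - L) + (card {s \<in> ?F. s < c} + card R)"
  proof -
    have "card ({s \<in> ?F. s < c} \<times> {y} \<union> R) = card {s \<in> ?F. s < c} + card R"
      using finR by (subst card_Un_disjoint) (auto simp: R_def card_cartesian_product)
    moreover have "(p_boxes B \<phi> - L) \<inter> ({s \<in> ?F. s < c} \<times> {y} \<union> R) = {}"
      using top_notin by (auto simp: R_def p_boxes_def)
    ultimately show ?thesis
      unfolding P using finP finR by (subst card_Un_disjoint) auto
  qed
  moreover have "card (p_boxes B \<phi> - L) + card L = card (p_boxes B \<phi>)"
    using \<open>L \<subseteq> p_boxes B \<phi>\<close> finP finL card_mono[OF finP, of L] by (simp add: card_Diff_subset)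
  ultimately have cP: "card (p_boxes B' ?\<psi>) = card (p_boxes B \<phi>) + card {s \<in> ?F. s < c}"
    using LR by simp
  have cQ: "card (q_boxes B' ?\<psi>) = card (q_boxes B \<phi>) + card {s \<in> ?F. c < s}"
    unfolding Q using fin top_notin
    by (subst card_Un_disjoint) (auto simp: q_boxes_alt card_cartesian_product)
  show ?thesis
    unfolding rook_weight_def cP cQ by (simp add: power_add mult_ac)
qed

lemma insert_top_rook:
  assumes "c < x" "c \<notin> fst ` \<phi>"
  shows "insert (c, y) \<phi> \<in> rook_placements B' (Suc k)"
proof (rule rook_placementsI)
  have "y \<notin> snd ` \<phi>"
    using \<phi>_row_less by force
  then show "inj_on snd (insert (c, y) \<phi>)" "inj_on fst (insert (c, y) \<phi>)"
    using rook_placementsD(4,5)[OF \<phi>] assms(2) by auto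
qed (use assms rook_placementsD(1-3)[OF \<phi>] top_notin in auto)

end

text \<open>The top row holds at most one rook. Removing it leaves \<open>k\<close> rooks on
  \<open>B\<close> that avoid its column.\<close>

lemma rook_placements_Suc:
  "rook_placements B' (Suc k) = rook_placements B (Suc k) \<union>
    (\<lambda>(\<phi>, c). insert (c, y) \<phi>) ` (SIGMA \<phi>:rook_placements B k. {..<x} - fst ` \<phi>)"
  (is "?l = ?r")
proof (intro equalityI subsetI)
  fix \<psi> assume \<psi>: "\<psi> \<in> ?l"
  note D = rook_placementsD[OF \<psi>]
  show "\<psi> \<in> ?r"
  proof (cases "\<exists>c. (c, y) \<in> \<psi>")
    case False
    then have "\<psi> \<subseteq> B" using D(1) by auto
    then show ?thesis using D by (blast intro: rook_placementsI)
  next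
    case True
    then obtain c where c: "(c, y) \<in> \<psi>" by blast
    define \<phi> where "\<phi> = \<psi> - {(c, y)}"
    have "(s, y) \<notin> \<phi>" for s
      using inj_onD[OF D(5), of "(s, y)" "(c, y)"] c by (auto simp: \<phi>_def)
    then have "\<phi> \<subseteq> B"
      using D(1) by (auto simp: \<phi>_def)
    then have "\<phi> \<in> rook_placements B k"
      using D(2-5) c by (intro rook_placementsI) (auto simp: \<phi>_def intro: inj_on_subset)
    moreover have "c < x"
      using D(1) c col_less by auto
    moreover have "c \<notin> fst ` \<phi>"
      using inj_onD[OF D(4), of _ "(c, y)"] c by (auto simp: \<phi>_def)
    moreover have "\<psi> = insert (c, y) \<phi>"
      using c by (auto simp: \<phi>_def)
    ultimately show ?thesis
      by (intro UnI2 image_eqI[of _ _ "(\<phi>, c)"]) auto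
  qed
next
  fix \<psi> assume "\<psi> \<in> ?r"
  then show "\<psi> \<in> ?l"
  proof
    assume "\<psi> \<in> rook_placements B (Suc k)"
    from rook_placementsD[OF this] show ?thesis
      by (intro rook_placementsI) auto
  next
    assume "\<psi> \<in> (\<lambda>(\<phi>, c). insert (c, y) \<phi>) ` (SIGMA \<phi>:rook_placements B k. {..<x} - fst ` \<phi>)"
    then show ?thesis using insert_top_rook by auto
  qed
qed

text \<open>The pair of \<open>\<phi>\<close> and \<open>c\<close> can be read off the enlarged
  placement, whose only rook in row \<open>y\<close> is the new one. For fixed
  \<open>\<phi>\<close>, summing over the free columns \<open>c\<close> produces the
  \<open>pq_number\<close> of \<open>x - k\<close>, independently of \<open>\<phi>\<close>.\<close>

lemma rook_number_Suc:
  "rook_number h p q B' (Suc k) = p ^ Suc k * q ^ (x - Suc k) * rook_number h p q B (Suc k)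
     + h * pq_number p q (x - k) * rook_number h p q B k"
proof -
  let ?S = "SIGMA \<phi>:rook_placements B k. {..<x} - fst ` \<phi>"
  let ?f = "\<lambda>(\<phi>, c). insert (c, y) \<phi>"
  let ?w = "rook_weight h p q B' (Suc k)"
  have inj: "inj_on ?f ?S"
  proof (rule inj_onI, clarify)
    fix \<phi> c \<phi>' c'
    assume *: "\<phi> \<in> rook_placements B k" "\<phi>' \<in> rook_placements B k"
      and eq: "insert (c, y) \<phi> = insert (c', y) \<phi>'"
    note N = top_notin(1)[OF *(1)] top_notin(1)[OF *(2)]
    have "c = c'" using eq N by blast
    then show "\<phi> = \<phi>' \<and> c = c'"
      using eq N insert_ident[of "(c, y)" \<phi> \<phi>'] by simp
  qed
  have "rook_placements B (Suc k) \<inter> ?f ` ?S = {}"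
    using top_notin(1) by auto
  then have "rook_number h p q B' (Suc k) = sum ?w (rook_placements B (Suc k)) + sum ?w (?f ` ?S)"
    unfolding rook_number_def rook_placements_Suc
    by (intro sum.union_disjoint finite_imageI finite_SigmaI finite_rook_placements fin) auto
  moreover have "sum ?w (rook_placements B (Suc k))
      = p ^ Suc k * q ^ (x - Suc k) * rook_number h p q B (Suc k)"
    unfolding rook_number_def sum_distrib_left
    by (intro sum.cong refl rook_weight_empty_row)
  moreover have "sum ?w (?f ` ?S) = (\<Sum>(\<phi>, c)\<in>?S. ?w (insert (c, y) \<phi>))"
    by (subst sum.reindex[OF inj]) (simp add: case_prod_beta' o_def)
  moreover have "\<dots> = (\<Sum>\<phi>\<in>rook_placements B k. \<Sum>c\<in>{..<x} - fst ` \<phi>. ?w (insert (c, y) \<phi>))"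
    by (rule sum.Sigma[symmetric]) (auto intro: finite_rook_placements fin)
  moreover have "\<dots> = (\<Sum>\<phi>\<in>rook_placements B k.
      h * pq_number p q (x - k) * rook_weight h p q B k \<phi>)"
  proof (rule sum.cong[OF refl])
    fix \<phi> assume \<phi>: "\<phi> \<in> rook_placements B k"
    let ?F = "{..<x} - fst ` \<phi>"
    have "(\<Sum>c\<in>?F. ?w (insert (c, y) \<phi>)) =
        (\<Sum>c\<in>?F. h * (p ^ card {s \<in> ?F. s < c} * q ^ card {s \<in> ?F. c < s}) * rook_weight h p q B k \<phi>)"
      by (intro sum.cong refl rook_weight_rook_in_row[OF \<phi>]) auto
    also have "\<dots> = h * pq_number p q (x - k) * rook_weight h p q B k \<phi>"
      using sum_over_set_eq_pq_number[of ?F p q] card_free[OF \<phi>]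
      by (simp flip: sum_distrib_left sum_distrib_right)
    finally show "(\<Sum>c\<in>?F. ?w (insert (c, y) \<phi>)) = \<dots>" .
  qed
  ultimately show ?thesis
    by (simp add: rook_number_def sum_distrib_left)
qed

lemma rook_number_0_top_row: "rook_number h p q B' 0 = q ^ x * rook_number h p q B 0"
proof -
  have "card B' = card B + x"
    using fin by (subst card_Un_disjoint) (auto simp: card_cartesian_product dest: row_less)
  then show ?thesis by (simp add: rook_number_0 power_add)
qed

end

section \<open>Ferrers boards of words, built letter by letter\<close>

lemma ferrers_board_Nil: "ferrers_board [] = {}"
  by (simp add: ferrers_board_def)

text \<open>Split the pairs \<open>i < j\<close> by whether \<open>j\<close> is the new last
  position. Earlier pairs see the same prefixes as before; the last position yields boxes only if
  its letter is \<open>LY\<close>, and then in row \<open>count_list w LY\<close>.\<close>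

lemma ferrers_board_snoc:
  "ferrers_board (w @ [a]) = ferrers_board w \<union>
    {(count_list (take i w) LX, count_list w LY) | i. i < length w \<and> w ! i = LX \<and> a = LY}"
proof -
  define P where "P i j b \<longleftrightarrow> b = (count_list (take i (w @ [a])) LX, count_list (take j (w @ [a])) LY) \<and>
    (w @ [a]) ! i = LX \<and> (w @ [a]) ! j = LY" for i j b
  have "ferrers_board (w @ [a]) = {b. \<exists>i j. i < j \<and> j < Suc (length w) \<and> P i j b}"
    by (auto simp: ferrers_board_def P_def)
  also have "\<dots> = {b. \<exists>i j. i < j \<and> j < length w \<and> P i j b} \<union> {b. \<exists>i<length w. P i (length w) b}"
    by (auto simp: less_Suc_eq)
  also have "{b. \<exists>i j. i < j \<and> j < length w \<and> P i j b} = ferrers_board w"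
  proof -
    have "i < j \<and> j < length w \<and> P i j b \<longleftrightarrow>
        b = (count_list (take i w) LX, count_list (take j w) LY) \<and>
        i < j \<and> j < length w \<and> w ! i = LX \<and> w ! j = LY" for i j b
      by (cases "i < j \<and> j < length w") (auto simp: P_def nth_append)
    then show ?thesis
      unfolding ferrers_board_def by simp
  qed
  also have "{b. \<exists>i<length w. P i (length w) b} =
      {(count_list (take i w) LX, count_list w LY) | i. i < length w \<and> w ! i = LX \<and> a = LY}"
    by (auto simp: P_def nth_append)
  finally show ?thesis .
qed

lemma ferrers_board_snoc_X: "ferrers_board (w @ [LX]) = ferrers_board w"
  by (simp add: ferrers_board_snoc)

text \<open>Numbering the occurrences of \<open>a\<close> by how many precede them leaves no gaps.
  Hence the row added by a \<open>Y\<close> meets every column.\<close>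

lemma less_count_list_iff:
  "c < count_list w a \<longleftrightarrow> (\<exists>i<length w. w ! i = a \<and> count_list (take i w) a = c)"
proof (induction w rule: rev_induct)
  case (snoc b w)
  define P where "P i \<longleftrightarrow> (w @ [b]) ! i = a \<and> count_list (take i (w @ [b])) a = c" for i
  have "(\<exists>i<length (w @ [b]). P i) \<longleftrightarrow> (\<exists>i<length w. P i) \<or> P (length w)"
    by (auto simp: less_Suc_eq)
  also have "(\<exists>i<length w. P i) \<longleftrightarrow> (\<exists>i<length w. w ! i = a \<and> count_list (take i w) a = c)"
    by (intro ex_cong1 conj_cong refl) (simp add: P_def nth_append)
  also have "P (length w) \<longleftrightarrow> b = a \<and> count_list w a = c"
    by (simp add: P_def)
  finally have "(\<exists>i<length (w @ [b]). P i) \<longleftrightarrow> c < count_list w a \<or> b = a \<and> count_list w a = c"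
    unfolding snoc .
  also have "\<dots> \<longleftrightarrow> c < count_list (w @ [b]) a"
    by auto
  finally show ?case
    unfolding P_def ..
qed simp

lemma ferrers_board_snoc_Y:
  "ferrers_board (w @ [LY]) = ferrers_board w \<union> {..<count_list w LX} \<times> {count_list w LY}"
  using less_count_list_iff[of _ w LX] unfolding ferrers_board_snoc by auto

text \<open>Appending an \<open>X\<close> only widens the rectangle; appending a \<open>Y\<close>
  adds a full row, which is left closed.\<close>

lemma rectangle_board_ferrers_board: "rectangle_board (ferrers_board w) (count_list w LX) (count_list w LY)"
proof (induction w rule: rev_induct)
  case Nil
  show ?case by unfold_locales (auto simp: ferrers_board_Nil)
next
  case (snoc a w)
  interpret rectangle_board "ferrers_board w" "count_list w LX" "count_list w LY"
    by (fact snoc)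
  show ?case
  proof (cases a)
    case LX
    show ?thesis unfolding LX ferrers_board_snoc_X
      by unfold_locales (use in_rectangle left_closed in \<open>force+\<close>)
  next
    case LY
    show ?thesis unfolding LY ferrers_board_snoc_Y
      by unfold_locales (use in_rectangle left_closed in \<open>force+\<close>)
  qed
qed

section \<open>Normal ordering in the deformed Weyl algebra\<close>

text \<open>Scalars are supported on the empty word, which is neutral for concatenation. They
  therefore commute with each monomial, and induction on finite supports extends this to all
  elements.\<close>

lemma free_const_commute: "free_const c * a = a * free_const c"
proof (induction a rule: update_induct)
  case const
  show ?case by simp
next
  case (update f w v)
  have "Poly_Mapping.update w v f = f + Poly_Mapping.single w v"
    using update.hyps
    by (intro poly_mapping_eqI) (auto simp: lookup_update lookup_add lookup_single in_keys_iff)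
  moreover have "free_const c * Poly_Mapping.single w v = Poly_Mapping.single w v * free_const c"
    by (simp add: free_const_def mult_single mult.commute)
  ultimately show ?case
    using update by (simp add: distrib_left distrib_right)
qed

lemma free_const_left_commute: "a * (free_const c * b) = free_const c * (a * b)"
  by (metis free_const_commute mult.assoc)

lemma free_const_add: "free_const (a + b) = free_const a + free_const b"
  and free_const_mult: "free_const (a * b) = free_const a * free_const b"
  and free_const_0: "free_const 0 = 0"
  and free_const_1: "free_const 1 = 1"
  by (simp_all add: free_const_def single_add mult_single)

lemma free_const_power_Suc: "free_const (c ^ Suc k) = free_const c * free_const (c ^ k)"
  by (simp add: free_const_mult)

section \<open>The quotient map and congruence modulo the relators\<close>

lemma ring_hom_weyl_class: "weyl_class h p q \<in> ring_hom free_alg (weyl_alg h p q)"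
  unfolding weyl_class_def[abs_def] weyl_alg_def
  by (rule ideal.rcos_ring_hom[OF ideal_weyl_ideal])

lemma weyl_class_closed: "weyl_class h p q a \<in> carrier (weyl_alg h p q)"
  using ring_hom_closed[OF ring_hom_weyl_class] by (simp add: free_alg_def)

lemma weyl_class_mult:
  "weyl_class h p q (a * b) = weyl_class h p q a \<otimes>\<^bsub>weyl_alg h p q\<^esub> weyl_class h p q b"
  using ring_hom_mult[OF ring_hom_weyl_class, of a b] by (simp add: free_alg_def)

lemma weyl_class_add:
  "weyl_class h p q (a + b) = weyl_class h p q a \<oplus>\<^bsub>weyl_alg h p q\<^esub> weyl_class h p q b"
  using ring_hom_add[OF ring_hom_weyl_class, of a b] by (simp add: free_alg_def)

lemma weyl_class_1: "weyl_class h p q 1 = \<one>\<^bsub>weyl_alg h p q\<^esub>"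
  using ring_hom_one[OF ring_hom_weyl_class] by (simp add: free_alg_def)

lemma weyl_class_0: "weyl_class h p q 0 = \<zero>\<^bsub>weyl_alg h p q\<^esub>"
  using ring_hom_zero[OF ring_hom_weyl_class ring_free_alg ring_weyl_alg]
  by (simp add: free_alg_def)

lemma weyl_class_power:
  "weyl_class h p q (a ^ k) = weyl_class h p q a [^]\<^bsub>weyl_alg h p q\<^esub> k"
proof -
  interpret ring "weyl_alg h p q" by (rule ring_weyl_alg)
  show ?thesis
    by (induction k) (simp_all add: weyl_class_1 weyl_class_mult power_Suc2 del: power_Suc)
qed

lemma weyl_class_sum:
  assumes "finite A"
  shows "weyl_class h p q (sum f A) = (\<Oplus>\<^bsub>weyl_alg h p q\<^esub> k \<in> A. weyl_class h p q (f k))"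
proof -
  interpret ring "weyl_alg h p q" by (rule ring_weyl_alg)
  show ?thesis
    using assms by (induction A) (simp_all add: weyl_class_0 weyl_class_add weyl_class_closed)
qed

primrec free_letter :: "letter \<Rightarrow> free_poly"
  where
    "free_letter LX = free_gen GenX"
  | "free_letter LY = free_gen GenY"

context
  fixes h p q :: complex
begin

text \<open>Calculations take place on representatives in the free algebra: ordinary ring equalities
  alternate with congruence steps that invoke a relation.\<close>

private abbreviation weyl_eq :: "free_poly \<Rightarrow> free_poly \<Rightarrow> bool"  (infix "\<approx>" 50)
  where "a \<approx> b \<equiv> weyl_class h p q a = weyl_class h p q b"

lemma weyl_eq_mult: "a \<approx> a' \<Longrightarrow> b \<approx> b' \<Longrightarrow> a * b \<approx> a' * b'"
  and weyl_eq_add: "a \<approx> a' \<Longrightarrow> b \<approx> b' \<Longrightarrow> a + b \<approx> a' + b'"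
  by (simp_all add: weyl_class_mult weyl_class_add)

lemma weyl_eq_sum: "(\<And>k. k \<in> A \<Longrightarrow> f k \<approx> g k) \<Longrightarrow> sum f A \<approx> sum g A"
  by (induction A rule: infinite_finite_induct) (simp_all add: weyl_class_add)

text \<open>Write \<open>a = (a - b) + b\<close>; the first summand lies in the ideal, so its class
  is zero.\<close>

lemma weyl_eqI: assumes "a - b \<in> weyl_ideal h p q" shows "a \<approx> b"
proof -
  interpret ring free_alg by (rule ring_free_alg)
  interpret ideal "weyl_ideal h p q" free_alg by (rule ideal_weyl_ideal)
  interpret W: ring "weyl_alg h p q" by (rule ring_weyl_alg)
  have "weyl_class h p q (a - b) = \<zero>\<^bsub>weyl_alg h p q\<^esub>"
    using a_rcos_const[OF assms] by (simp add: weyl_class_def weyl_alg_def FactRing_def)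
  then show ?thesis
    using weyl_class_add[of h p q "a - b" b] by (simp add: weyl_class_closed)
qed

lemma weyl_relator_in_ideal: "a \<in> weyl_relators h p q \<Longrightarrow> a \<in> weyl_ideal h p q"
  using ring.genideal_self[OF ring_free_alg, of "weyl_relators h p q"]
  by (auto simp: weyl_ideal_def free_alg_def)

private abbreviation (input) X where "X \<equiv> free_gen GenX"
private abbreviation (input) Y where "Y \<equiv> free_gen GenY"
private abbreviation (input) Z where "Z \<equiv> free_gen GenZ"

section \<open>Commutation rules for powers of the generators\<close>

lemma X_Y: "X * Y \<approx> free_const q * (Y * X) + free_const h * Z"
  and Z_Y: "Z * Y \<approx> free_const p * (Y * Z)"
  and X_Z: "X * Z \<approx> free_const p * (Z * X)"
  by (rule weyl_eqI, rule weyl_relator_in_ideal, simp add: weyl_relators_def Let_def diff_diff_eq)+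

lemma Z_power_Y: "Z ^ k * Y \<approx> free_const (p ^ k) * (Y * Z ^ k)"
proof (induction k)
  case 0
  show ?case by (simp add: free_const_1)
next
  case (Suc k)
  have "Z ^ Suc k * Y = Z ^ k * (Z * Y)"
    by (simp add: power_Suc2 mult.assoc del: power_Suc)
  also have "\<dots> \<approx> Z ^ k * (free_const p * (Y * Z))"
    by (intro weyl_eq_mult refl Z_Y)
  also have "Z ^ k * (free_const p * (Y * Z)) = free_const p * (Z ^ k * Y * Z)"
    by (simp add: free_const_left_commute mult.assoc)
  also have "\<dots> \<approx> free_const p * (free_const (p ^ k) * (Y * Z ^ k) * Z)"
    by (intro weyl_eq_mult refl Suc)
  also have "free_const p * (free_const (p ^ k) * (Y * Z ^ k) * Z)
      = free_const (p ^ Suc k) * (Y * Z ^ Suc k)"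
    by (simp only: free_const_power_Suc power_Suc2[of Z k] mult.assoc)
  finally show ?case .
qed

lemma X_power_Z: "X ^ k * Z \<approx> free_const (p ^ k) * (Z * X ^ k)"
proof (induction k)
  case 0
  show ?case by (simp add: free_const_1)
next
  case (Suc k)
  have "X ^ Suc k * Z = X ^ k * (X * Z)"
    by (simp add: power_Suc2 mult.assoc del: power_Suc)
  also have "\<dots> \<approx> X ^ k * (free_const p * (Z * X))"
    by (intro weyl_eq_mult refl X_Z)
  also have "X ^ k * (free_const p * (Z * X)) = free_const p * (X ^ k * Z * X)"
    by (simp add: free_const_left_commute mult.assoc)
  also have "\<dots> \<approx> free_const p * (free_const (p ^ k) * (Z * X ^ k) * X)"
    by (intro weyl_eq_mult refl Suc)
  also have "free_const p * (free_const (p ^ k) * (Z * X ^ k) * X)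
      = free_const (p ^ Suc k) * (Z * X ^ Suc k)"
    by (simp only: free_const_power_Suc power_Suc2[of X k] mult.assoc)
  finally show ?case .
qed

text \<open>Apply the relation to the innermost \<open>X * Y\<close>, then the induction hypothesis
  to \<open>X ^ k * Y\<close> and \<open>X_power_Z\<close> to \<open>X ^ k * Z\<close>. The
  coefficients of \<open>Z * X ^ k\<close> add up by the recursion of
  \<open>pq_number\<close>.\<close>

lemma X_power_Y:
  "X ^ k * Y \<approx> free_const (q ^ k) * (Y * X ^ k) + free_const (h * pq_number p q k) * (Z * X ^ (k - 1))"
proof (induction k)
  case 0
  show ?case by (simp add: free_const_1 free_const_0)
next
  case (Suc k)
  let ?c = "free_const (h * pq_number p q k)"
  \<comment> \<open>For \<open>k = 0\<close> the truncated exponent spoils the power of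
    \<open>X\<close>, but then \<open>?c\<close> is 0.\<close>
  have X: "?c * (Z * (X ^ (k - Suc 0) * X)) = ?c * (Z * X ^ k)"
    by (cases k) (simp_all add: free_const_0 power_Suc2 del: power_Suc)
  have "X ^ Suc k * Y = X ^ k * (X * Y)"
    by (simp add: power_Suc2 mult.assoc del: power_Suc)
  also have "\<dots> \<approx> X ^ k * (free_const q * (Y * X) + free_const h * Z)"
    by (intro weyl_eq_mult refl X_Y)
  also have "X ^ k * (free_const q * (Y * X) + free_const h * Z)
      = free_const q * (X ^ k * Y * X) + free_const h * (X ^ k * Z)"
    by (simp add: free_const_left_commute mult.assoc distrib_left)
  also have "\<dots> \<approx> free_const q * ((free_const (q ^ k) * (Y * X ^ k) + ?c * (Z * X ^ (k - 1))) * X)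
      + free_const h * (free_const (p ^ k) * (Z * X ^ k))"
    by (intro weyl_eq_add weyl_eq_mult refl Suc X_power_Z)
  also have "free_const q * ((free_const (q ^ k) * (Y * X ^ k) + ?c * (Z * X ^ (k - 1))) * X)
      + free_const h * (free_const (p ^ k) * (Z * X ^ k))
      = free_const q * (free_const (q ^ k) * (Y * (X ^ k * X))) + free_const q * (?c * (Z * X ^ k))
        + free_const h * (free_const (p ^ k) * (Z * X ^ k))"
    by (simp add: mult.assoc distrib_left distrib_right X)
  also have "\<dots> = free_const (q ^ Suc k) * (Y * X ^ Suc k)
      + free_const (h * pq_number p q (Suc k)) * (Z * X ^ (Suc k - 1))"
  proof -
    have "free_const (h * pq_number p q (Suc k)) = free_const q * ?c + free_const h * free_const (p ^ k)"
      by (simp add: distrib_left mult.left_commute flip: free_const_mult free_const_add)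
    then show ?thesis
      by (simp only: free_const_power_Suc power_Suc2[of X k] diff_Suc_1 distrib_right mult.assoc add.assoc)
  qed
  finally show ?case .
qed

private abbreviation (input) T where "T a k b \<equiv> Y ^ a * Z ^ k * X ^ b"

text \<open>The new \<open>Y\<close> passes \<open>X ^ b\<close> and then \<open>Z ^ k\<close>. The
  \<open>Z\<close> created on the way already stands next to \<open>Z ^ k\<close>, so that summand
  gains no power of \<open>p\<close> from reordering.\<close>

lemma normal_form_Y:
  "T a k b * Y \<approx> free_const (p ^ k * q ^ b) * T (Suc a) k b
     + free_const (h * pq_number p q b) * T a (Suc k) (b - 1)"
proof -
  let ?d = "free_const (h * pq_number p q b)"
  have "T a k b * Y = Y ^ a * Z ^ k * (X ^ b * Y)"
    by (simp add: mult.assoc)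
  also have "\<dots> \<approx> Y ^ a * Z ^ k * (free_const (q ^ b) * (Y * X ^ b) + ?d * (Z * X ^ (b - 1)))"
    by (intro weyl_eq_mult refl X_power_Y)
  also have "Y ^ a * Z ^ k * (free_const (q ^ b) * (Y * X ^ b) + ?d * (Z * X ^ (b - 1)))
     = free_const (q ^ b) * (Y ^ a * (Z ^ k * Y) * X ^ b) + ?d * T a (Suc k) (b - 1)"
    by (simp add: distrib_left free_const_left_commute mult.assoc power_Suc2 del: power_Suc)
  also have "\<dots> \<approx> free_const (q ^ b) * (Y ^ a * (free_const (p ^ k) * (Y * Z ^ k)) * X ^ b)
      + ?d * T a (Suc k) (b - 1)"
    by (intro weyl_eq_mult weyl_eq_add refl Z_power_Y)
  also have "Y ^ a * (free_const (p ^ k) * (Y * Z ^ k)) * X ^ b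
      = free_const (p ^ k) * T (Suc a) k b"
    by (simp add: free_const_left_commute mult.assoc power_Suc2 del: power_Suc)
  also have "free_const (q ^ b) * (free_const (p ^ k) * T (Suc a) k b)
      = free_const (p ^ k * q ^ b) * T (Suc a) k b"
    by (simp only: mult.commute[of "p ^ k" "q ^ b"] free_const_mult mult.assoc)
  finally show ?thesis .
qed

section \<open>Normal ordering of arbitrary words\<close>

lemma weyl_word_eq_class: "weyl_word h p q w = weyl_class h p q (prod_list (map free_letter w))"
proof (induction w)
  case (Cons a w)
  have "weyl_letter h p q a = weyl_class h p q (free_letter a)"
    by (cases a) (simp_all add: weyl_X_def weyl_Y_def)
  with Cons show ?case by (simp add: weyl_class_mult)
qed (simp add: weyl_class_1)

text \<open>The bound \<open>count_list w LX\<close> depends on letter counts alone, which suits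
  induction over appended letters; the sharper bound for the special words comes afterwards.\<close>

lemma normal_ordering:
  "prod_list (map free_letter w) \<approx>
    (\<Sum>k\<le>count_list w LX. free_const (rook_number h p q (ferrers_board w) k)
       * T (count_list w LY - k) k (count_list w LX - k))"
proof (induction w rule: rev_induct)
  case Nil
  show ?case
    by (simp add: ferrers_board_Nil rook_number_0 free_const_1)
next
  case (snoc a w)
  interpret rectangle_board "ferrers_board w" "count_list w LX" "count_list w LY"
    by (rule rectangle_board_ferrers_board)
  let ?m = "count_list w LX" and ?n = "count_list w LY"
  let ?R = "rook_number h p q (ferrers_board w)"
  let ?R' = "rook_number h p q (ferrers_board (w @ [a]))"
  let ?S = "\<Sum>k\<le>?m. free_const (?R k) * T (?n - k) k (?m - k)"
  have "prod_list (map free_letter w) * free_letter a \<approx> ?S * free_letter a"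
    by (intro weyl_eq_mult refl snoc)
  moreover have "?S * free_letter a \<approx> (\<Sum>k\<le>count_list (w @ [a]) LX. free_const (?R' k)
      * T (count_list (w @ [a]) LY - k) k (count_list (w @ [a]) LX - k))"
  proof (cases a)
    case LX
    \<comment> \<open>The range grows by one index, but the board still fits in \<open>?m\<close>
      columns.\<close>
    have "?R (Suc ?m) = 0"
      using in_rectangle by (intro rook_number_eq_0_cols[of _ ?m]) auto
    then show ?thesis
      unfolding LX ferrers_board_snoc_X
      by (simp add: free_const_0 sum_distrib_right mult.assoc Suc_diff_le power_Suc2
          del: power_Suc)
  next
    case LY
    \<comment> \<open>\<open>t k\<close> is the monomial of index \<open>k\<close> for the longer
      word. \<open>f k\<close> stems from an empty top row; \<open>g k\<close> stems from a rook in
      it and so belongs to index \<open>Suc k\<close>.\<close>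
    define t where "t k = T (Suc ?n - k) k (?m - k)" for k
    define f where "f k = free_const (p ^ k * q ^ (?m - k) * ?R k) * t k" for k
    define g where "g k = free_const (h * pq_number p q (?m - k) * ?R k) * t (Suc k)" for k
    have "?S * Y = (\<Sum>k\<le>?m. free_const (?R k) * (T (?n - k) k (?m - k) * Y))"
      by (simp add: sum_distrib_right mult.assoc)
    also have "\<dots> \<approx> (\<Sum>k\<le>?m. f k + g k)"
    proof (rule weyl_eq_sum)
      fix k
      show "free_const (?R k) * (T (?n - k) k (?m - k) * Y) \<approx> f k + g k"
      \<comment> \<open>Only for \<open>k \<le> ?n\<close> is \<open>Suc (?n - k)\<close> equal to
        \<open>Suc ?n - k\<close>; beyond that the rook number vanishes.\<close>
      proof (cases "k \<le> ?n")
        case True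
        have "free_const (?R k) * (T (?n - k) k (?m - k) * Y) \<approx> free_const (?R k) *
          (free_const (p ^ k * q ^ (?m - k)) * T (Suc (?n - k)) k (?m - k)
           + free_const (h * pq_number p q (?m - k)) * T (?n - k) (Suc k) (?m - k - 1))"
          by (intro weyl_eq_mult refl normal_form_Y)
        also have "free_const (?R k) *
          (free_const (p ^ k * q ^ (?m - k)) * T (Suc (?n - k)) k (?m - k)
           + free_const (h * pq_number p q (?m - k)) * T (?n - k) (Suc k) (?m - k - 1))
           = f k + g k"
          using True unfolding f_def g_def t_def
          by (simp add: Suc_diff_le distrib_left mult.commute[of _ "?R k"] free_const_mult[of "?R k"]
              mult.assoc[of "free_const (?R k)"])
        finally show ?thesis .
      next
        case False
        then have "?R k = 0"
          using in_rectangle by (intro rook_number_eq_0_rows[of _ ?n]) auto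
        then show ?thesis by (simp add: f_def g_def free_const_0)
      qed
    qed
    also have "(\<Sum>k\<le>?m. f k + g k) = (\<Sum>k\<le>?m. f k) + (\<Sum>k<?m. g k)"
    proof -
      \<comment> \<open>With \<open>?m\<close> rooks no column is free for a rook in the new row:
        the factor is \<open>pq_number p q 0\<close>.\<close>
      have "g ?m = 0" by (simp add: g_def free_const_0)
      then show ?thesis by (simp add: sum.distrib flip: lessThan_Suc_atMost)
    qed
    also have "\<dots> = f 0 + (\<Sum>k<?m. f (Suc k) + g k)"
      by (simp add: sum.atMost_shift sum.distrib)
    also have "\<dots> = (\<Sum>k\<le>?m. free_const (?R' k) * t k)"
    proof -
      have "?R' 0 = p ^ 0 * q ^ (?m - 0) * ?R 0"
        unfolding LY ferrers_board_snoc_Y by (simp add: rook_number_0_top_row)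
      moreover have "?R' (Suc k) = p ^ Suc k * q ^ (?m - Suc k) * ?R (Suc k)
          + h * pq_number p q (?m - k) * ?R k" for k
        unfolding LY ferrers_board_snoc_Y by (rule rook_number_Suc)
      ultimately show ?thesis
        unfolding sum.atMost_shift[of _ ?m] f_def g_def
        by (simp only: free_const_add distrib_right)
    qed
    finally show ?thesis
      unfolding LY t_def by (simp add: free_letter.simps)
  qed
  ultimately show ?case by simp
qed

end

section \<open>The words with prescribed exponents and the upper summation bound\<close>

lemma count_list_replicate: "count_list (replicate k a) b = (if a = b then k else 0)"
  by (induction k) auto

lemma count_list_word_mn:
  "count_list (word_mn r m n) LX = (\<Sum>j=1..r. m j)"
  "count_list (word_mn r m n) LY = (\<Sum>j=1..r. n j)"
proof -
  have "count_list (word_mn r m n) LX = (\<Sum>j=1..r. m j) \<and>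
      count_list (word_mn r m n) LY = (\<Sum>j=1..r. n j)"
    by (induction r) (simp_all add: word_mn_def count_list_replicate)
  then show "count_list (word_mn r m n) LX = (\<Sum>j=1..r. m j)"
    "count_list (word_mn r m n) LY = (\<Sum>j=1..r. n j)" by simp_all
qed

lemma word_mn_last_block:
  assumes "r \<ge> 1"
  obtains w where "word_mn r m n = w @ replicate (m 1) LX"
proof -
  have "[1..<Suc r] = 1 # [2..<Suc r]"
    using assms by (simp add: upt_rec numeral_2_eq_2)
  then show ?thesis
    using that by (simp add: word_mn_def)
qed

lemma ferrers_board_append_Xs: "ferrers_board (w @ replicate k LX) = ferrers_board w"
proof (induction k)
  case (Suc k)
  have "w @ replicate (Suc k) LX = (w @ replicate k LX) @ [LX]"
    by (simp add: replicate_append_same)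
  then show ?case using Suc ferrers_board_snoc_X by metis
qed simp

text \<open>The final \<open>m 1\<close> letters \<open>X\<close> have no \<open>Y\<close> to their
  right, so their columns are empty and the board fits in the remaining columns.\<close>

lemma rook_number_word_mn_eq_0:
  assumes "r \<ge> 1" "k > (\<Sum>j=1..r. m j) - m 1"
  shows "rook_number h p q (ferrers_board (word_mn r m n)) k = 0"
proof -
  obtain w where w: "word_mn r m n = w @ replicate (m 1) LX"
    using word_mn_last_block[OF assms(1)] .
  interpret rectangle_board "ferrers_board w" "count_list w LX" "count_list w LY"
    by (rule rectangle_board_ferrers_board)
  have "(\<Sum>j=1..r. m j) = count_list w LX + m 1"
    using count_list_word_mn(1)[of r m n] by (simp add: w count_list_replicate)
  then show ?thesis
    unfolding w ferrers_board_append_Xs using in_rectangle assms(2)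
    by (intro rook_number_eq_0_cols[of _ "count_list w LX"]) auto
qed

theorem theorem4p4:
  fixes p q h :: complex and r :: nat and m n :: "nat \<Rightarrow> nat"
  assumes "h \<noteq> 0" and "r \<ge> 1"
  shows "weyl_word h p q (word_mn r m n) =
    (\<Oplus>\<^bsub>weyl_alg h p q\<^esub> k \<in> {0..(\<Sum>j=1..r. m j) - m 1}.
       weyl_smult h p q (rook_number h p q (ferrers_board (word_mn r m n)) k)
         (weyl_Y h p q [^]\<^bsub>weyl_alg h p q\<^esub> ((\<Sum>j=1..r. n j) - k)
          \<otimes>\<^bsub>weyl_alg h p q\<^esub> weyl_Z h p q [^]\<^bsub>weyl_alg h p q\<^esub> k
          \<otimes>\<^bsub>weyl_alg h p q\<^esub> weyl_X h p q [^]\<^bsub>weyl_alg h p q\<^esub> ((\<Sum>j=1..r. m j) - k)))"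
proof -
  let ?R = "rook_number h p q (ferrers_board (word_mn r m n))"
  let ?M = "\<Sum>j=1..r. m j" and ?N = "\<Sum>j=1..r. n j"
  \<comment> \<open>For \<open>k > ?N\<close> the exponent \<open>?N - k\<close> is truncated to 0,
    harmlessly, since \<open>?R k\<close> is then 0.\<close>
  let ?t = "\<lambda>k. free_const (?R k) *
    (free_gen GenY ^ (?N - k) * free_gen GenZ ^ k * free_gen GenX ^ (?M - k))"
  have "weyl_word h p q (word_mn r m n) = weyl_class h p q (\<Sum>k\<le>?M. ?t k)"
    using normal_ordering[of h p q "word_mn r m n"]
    by (simp add: weyl_word_eq_class count_list_word_mn)
  also have "(\<Sum>k\<le>?M. ?t k) = (\<Sum>k\<in>{0..?M - m 1}. ?t k)"
    using rook_number_word_mn_eq_0[OF assms(2)]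
    by (intro sum.mono_neutral_right) (auto simp: free_const_0)
  also have "weyl_class h p q \<dots> = (\<Oplus>\<^bsub>weyl_alg h p q\<^esub> k \<in> {0..?M - m 1}. weyl_class h p q (?t k))"
    by (simp add: weyl_class_sum)
  finally show ?thesis
    by (simp add: weyl_class_mult weyl_class_power weyl_smult_def weyl_X_def weyl_Y_def weyl_Z_def)
qed

end
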